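(* Let $N\ge k+1$. There exist a family of request sequences $\{I_n\}_{n\ge1}$ respecting the access graph $P_N$ and a constant $b$ such that $\lim_{n\to\infty}\mathrm{LRU}(I_n)=\infty$ and, for all $n$, $$\mathrm{FIFO}^{P_N}_W(I_n)\ge \frac{k+1}{2}\,\mathrm{LRU}^{P_N}_W(I_n)+b.$$
   Context: Paging: a cache of size $k\ge1$, initially empty; on a request to a page not in cache (a fault) the page is brought in, evicting a page if the cache is full; $\mathrm{A}(I)$ is the number of faults of algorithm $\mathrm{A}$ on $I$. LRU evicts the least recently requested page in cache; FIFO evicts the page that has been in cache the longest. An access graph is an undirected graph whose vertices are the pages; a sequence respects it if any two consecutive requests are to the same page or to adjacent vertices. $P_N$ is the path graph on $N$ vertices. For an algorithm $\mathrm{A}$ and access graph $G$, $\mathrm{A}^G_W(I)=\max_\sigma \mathrm{A}(\sigma(I))$ over all permutations $\sigma$ of the requests of $I$ such that $\sigma(I)$ respects $G$. *)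

theory Defs
  imports
    Complex_Main
    "HOL-Combinatorics.Permutations"
    "Graph_Theory.Pair_Digraph"
begin

section \<open>Paging\<close>

record 'p paging_state =
  cache :: "'p set"
  last_request :: "'p \<Rightarrow> nat"
  load_time :: "'p \<Rightarrow> nat"
  now :: nat

text \<open>
  The time stamps are meaningful only for pages that are currently in the cache, so their initial
  values are irrelevant. The clock advances with every request; hence the time stamps of distinct
  pages in the cache are distinct and the minimisers below are unique.
\<close>

definition initial_state :: "'p paging_state" where
  "initial_state = \<lparr>cache = {}, last_request = (\<lambda>_. 0), load_time = (\<lambda>_. 0), now = 0\<rparr>"

definition lru_victim :: "'p paging_state \<Rightarrow> 'p" where
  "lru_victim s = arg_min_on (last_request s) (cache s)"

definition fifo_victim :: "'p paging_state \<Rightarrow> 'p" where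
  "fifo_victim s = arg_min_on (load_time s) (cache s)"

definition serve :: "nat \<Rightarrow> ('p paging_state \<Rightarrow> 'p) \<Rightarrow> 'p \<Rightarrow> 'p paging_state \<Rightarrow> 'p paging_state" where
  "serve k victim p s =
    \<lparr>cache =
       (if p \<in> cache s then cache s
        else insert p (if card (cache s) < k then cache s else cache s - {victim s})),
     last_request = (last_request s)(p := now s),
     load_time = (if p \<in> cache s then load_time s else (load_time s)(p := now s)),
     now = Suc (now s)\<rparr>"

fun faults_from ::
  "nat \<Rightarrow> ('p paging_state \<Rightarrow> 'p) \<Rightarrow> 'p paging_state \<Rightarrow> 'p list \<Rightarrow> nat" where
  "faults_from k victim s [] = 0"
| "faults_from k victim s (p # ps) =
    (if p \<in> cache s then 0 else 1) + faults_from k victim (serve k victim p s) ps"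

definition LRU :: "nat \<Rightarrow> 'p list \<Rightarrow> nat" where
  "LRU k I = faults_from k lru_victim initial_state I"

definition FIFO :: "nat \<Rightarrow> 'p list \<Rightarrow> nat" where
  "FIFO k I = faults_from k fifo_victim initial_state I"

section \<open>Access graphs\<close>

text \<open>
  Following the graph library, an undirected graph is a symmetric digraph: each undirected edge is
  represented by its two orientations.
\<close>

definition respects_graph :: "'p pair_pre_digraph \<Rightarrow> 'p list \<Rightarrow> bool" where
  "respects_graph G I \<longleftrightarrow>
    set I \<subseteq> pverts G \<and> successively (\<lambda>p q. p = q \<or> (p, q) \<in> parcs G) I"

definition path_graph :: "nat \<Rightarrow> nat pair_pre_digraph" where
  "path_graph N =
    \<lparr>pverts = {1..N},
     parcs = {(u, v). u \<in> {1..N} \<and> v \<in> {1..N} \<and> (v = Suc u \<or> u = Suc v)}\<rparr>"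

lemma pair_graph_path_graph: "pair_graph (path_graph N)"
proof
  show "finite (parcs (path_graph N))"
    by (rule finite_subset[of _ "{1..N} \<times> {1..N}"]) (auto simp: path_graph_def)
qed (auto simp: path_graph_def symmetric_def arcs_ends_def arc_to_ends_def intro!: symI)

text \<open>
  The maximum is over a finite set, which is nonempty whenever \<open>I\<close> itself respects \<open>G\<close>;
  otherwise the value may be unspecified.
\<close>

definition worst_order :: "('p list \<Rightarrow> nat) \<Rightarrow> 'p pair_pre_digraph \<Rightarrow> 'p list \<Rightarrow> nat" where
  "worst_order A G I =
    Max {A (permute_list \<sigma> I) | \<sigma>.
      \<sigma> permutes {..<length I} \<and> respects_graph G (permute_list \<sigma> I)}"

end

theory Submission
  imports Defs
begin

text \<open>
  The sequences sweep \<open>n\<close> times up and down the subpath \<open>1, \<dots>, k + 1\<close>. On this subpath the pages in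
  an LRU cache get older with the distance from the current request, so LRU, in whatever order the
  requests come, evicts only the ends \<open>1\<close> and \<open>k + 1\<close>; hence a sweep up and down costs it at most
  two faults, up to the initial loading of the inner pages. FIFO, having loaded the pages in
  increasing order, evicts on each upward sweep precisely the page requested next, so it faults
  on all \<open>k + 1\<close> of them.
\<close>

section \<open>Fault counts of concatenations and uniqueness of the victims\<close>

lemma faults_from_append:
  "faults_from k v s (xs @ ys) = faults_from k v s xs + faults_from k v (fold (serve k v) xs s) ys"
  by (induction xs arbitrary: s) auto

lemma lru_victim_in_cache:
  assumes "finite (cache s)" "cache s \<noteq> {}"
  shows "lru_victim s \<in> cache s"
  using arg_min_if_finite(1)[OF assms] by (simp add: lru_victim_def)

lemma lru_victim_eqI:
  assumes "finite (cache s)" "p \<in> cache s"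
    and "\<And>q. q \<in> cache s \<Longrightarrow> q \<noteq> p \<Longrightarrow> last_request s p < last_request s q"
  shows "lru_victim s = p"
  using arg_min_if_finite[of "cache s" "last_request s"] assms
  unfolding lru_victim_def by (metis empty_iff)

lemma fifo_victim_eqI:
  assumes "finite (cache s)" "p \<in> cache s"
    and "\<And>q. q \<in> cache s \<Longrightarrow> q \<noteq> p \<Longrightarrow> load_time s p < load_time s q"
  shows "fifo_victim s = p"
  using arg_min_if_finite[of "cache s" "load_time s"] assms
  unfolding fifo_victim_def by (metis empty_iff)


section \<open>LRU on the subpath\<close>

text \<open>
  \<open>V\<close> is the set of pages requested so far and \<open>c\<close> the last request (arbitrary if \<open>V\<close> is empty).
\<close>

definition lru_invar :: "nat \<Rightarrow> nat paging_state \<Rightarrow> nat set \<Rightarrow> nat \<Rightarrow> bool" where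
  "lru_invar k s V c \<longleftrightarrow>
    V \<subseteq> {1..k+1} \<and> cache s \<subseteq> V \<and> V \<inter> {2..k} \<subseteq> cache s \<and>
    (\<forall>x\<in>V. last_request s x < now s) \<and>
    (\<forall>x\<in>V. \<forall>y. (c \<le> y \<and> y < x) \<or> (x < y \<and> y \<le> c) \<longrightarrow>
       y \<in> V \<and> last_request s x < last_request s y)"

text \<open>At such a fault the cache consists of all pages of \<open>{1..k+1}\<close> except
  \<open>p\<close>, so every other page has been requested. Pages get older with the distance from
  \<open>c\<close>, and \<open>c\<close> is at most one step from \<open>p\<close>; hence if
  \<open>p\<close> is one end, the opposite end is the oldest page.\<close>

lemma lru_victim_endpoint:
  assumes inv: "lru_invar k s V c" and p: "p \<in> {1..k+1}" and k: "k \<ge> 1"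
    and step: "p = c \<or> p = Suc c \<or> c = Suc p"
    and fault: "p \<notin> cache s" and full: "\<not> card (cache s) < k"
  shows "p \<in> {1, k+1}" and "lru_victim s \<in> {1, k+1}"
proof -
  have sub: "cache s \<subseteq> {1..k+1} - {p}"
    using inv fault unfolding lru_invar_def by blast
  have "card ({1..k+1} - {p}) = k" using p by simp
  with full have cache: "cache s = {1..k+1} - {p}"
    using sub by (intro card_seteq) auto
  have V: "{1..k+1} - {p} \<subseteq> V"
    using inv cache unfolding lru_invar_def by blast
  have ord: "y \<in> V \<and> last_request s x < last_request s y"
    if "x \<in> V" "(c \<le> y \<and> y < x) \<or> (x < y \<and> y \<le> c)" for x y
    using inv that unfolding lru_invar_def by blast
  show p_end: "p \<in> {1, k+1}"
  proof (rule ccontr)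
    assume "p \<notin> {1, k+1}"
    then have mid: "p \<in> {2..k}" using p by auto
    then have "1 \<in> V" "k + 1 \<in> V" using V k by auto
    \<comment> \<open>Whichever side of \<open>p\<close> the last request lies on, \<open>p\<close>
      is between it and an end already requested, so \<open>p\<close> was requested too. A requested
      inner page is still cached, which contradicts the fault.\<close>
    then have "p \<in> V"
      using ord[of 1 p] ord[of "k+1" p] mid by (cases "p \<le> c") auto
    then show False using inv mid fault unfolding lru_invar_def by blast
  qed
  show "lru_victim s \<in> {1, k+1}"
  proof (cases "p = 1")
    case True
    have "lru_victim s = k + 1"
    proof (rule lru_victim_eqI)
      fix q assume "q \<in> cache s" "q \<noteq> k + 1"
      \<comment> \<open>Here \<open>c\<close> is at most 2, and \<open>q\<close> is at least 2
        because \<open>p = 1\<close> is not cached.\<close>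
      then have "c \<le> q \<and> q < k + 1" using sub step True by auto
      moreover have "k + 1 \<in> V" by (rule subsetD[OF V]) (use True k in auto)
      ultimately show "last_request s (k+1) < last_request s q" using ord by blast
    qed (use k in \<open>simp_all add: cache True\<close>)
    then show ?thesis by simp
  next
    case False
    then have p: "p = k + 1" using p_end by simp
    have "lru_victim s = 1"
    proof (rule lru_victim_eqI)
      fix q assume "q \<in> cache s" "q \<noteq> 1"
      then have "1 < q \<and> q \<le> c" using sub step p by auto
      moreover have "1 \<in> V" by (rule subsetD[OF V]) (use p k in auto)
      ultimately show "last_request s 1 < last_request s q" using ord by blast
    qed (use k in \<open>simp_all add: cache p\<close>)
    then show ?thesis by simp
  qed
qed

text \<open>Since \<open>p\<close> and \<open>c\<close> differ by at most one, a page strictly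
  beyond \<open>p\<close> in some direction is not passed over when the centre moves from
  \<open>c\<close> to \<open>p\<close>, so the order by age persists there; \<open>p\<close> itself
  becomes the newest page. Requested inner pages stay cached because only ends are evicted.\<close>

lemma lru_invar_serve:
  assumes inv: "lru_invar k s V c" and p: "p \<in> {1..k+1}" and k: "k \<ge> 1"
    and step: "p = c \<or> p = Suc c \<or> c = Suc p"
  shows "lru_invar k (serve k lru_victim p s) (insert p V) p"
proof -
  let ?s = "serve k lru_victim p s"
  have sub: "V \<subseteq> {1..k+1}" "cache s \<subseteq> V" "V \<inter> {2..k} \<subseteq> cache s"
    and now: "\<And>x. x \<in> V \<Longrightarrow> last_request s x < now s"
    using inv unfolding lru_invar_def by blast+
  have "cache ?s \<subseteq> insert p V"
    using sub by (auto simp: serve_def)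
  moreover have "insert p V \<inter> {2..k} \<subseteq> cache ?s"
    using sub lru_victim_endpoint(2)[OF assms] by (auto simp: serve_def)
  moreover have "y \<in> insert p V \<and> last_request ?s x < last_request ?s y"
    if "x \<in> insert p V" "(p \<le> y \<and> y < x) \<or> (x < y \<and> y \<le> p)" for x y
  proof -
    have x: "x \<in> V" "x \<noteq> p" using that by auto
    show ?thesis
    proof (cases "y = p")
      case True
      then show ?thesis using now[OF x(1)] x by (simp add: serve_def)
    next
      case False
      then have "(c \<le> y \<and> y < x) \<or> (x < y \<and> y \<le> c)" using that(2) step by auto
      then have "y \<in> V \<and> last_request s x < last_request s y"
        using inv x unfolding lru_invar_def by blast
      then show ?thesis using x False by (auto simp: serve_def)
    qed
  qed
  moreover have "\<forall>x\<in>insert p V. last_request ?s x < now ?s"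
    using now by (auto simp: serve_def less_Suc_eq)
  moreover have "insert p V \<subseteq> {1..k+1}" using sub p by auto
  ultimately show ?thesis unfolding lru_invar_def by blast
qed

text \<open>The last summand is a potential paying for the single fault on each inner page.\<close>

lemma lru_faults_le:
  assumes "lru_invar k s V c" and "k \<ge> 1" and "set ps \<subseteq> {1..k+1}"
    and "successively (\<lambda>p q. p = q \<or> q = Suc p \<or> p = Suc q) (c # ps)"
  shows "faults_from k lru_victim s ps \<le>
    count (mset ps) 1 + count (mset ps) (k+1) + card ({2..k} - cache s)"
  using assms
proof (induction ps arbitrary: s V c)
  case (Cons p ps)
  let ?s = "serve k lru_victim p s"
  have p: "p \<in> {1..k+1}" and step: "p = c \<or> p = Suc c \<or> c = Suc p"
    using Cons.prems by auto
  note inv = Cons.prems(1)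
  have "faults_from k lru_victim ?s ps \<le>
      count (mset ps) 1 + count (mset ps) (k+1) + card ({2..k} - cache ?s)"
    using Cons.prems by (intro Cons.IH[OF lru_invar_serve[OF inv p _ step]]) auto
  \<comment> \<open>Amortised cost of one request: a fault on an end is charged to the count of that
    end, a fault on an inner page to the drop of the potential.\<close>
  moreover have "(if p \<in> cache s then 0 else 1) + card ({2..k} - cache ?s) \<le>
      (if p \<in> {1, k+1} then 1 else 0) + card ({2..k} - cache s)"
  proof (cases "p \<in> cache s")
    case True
    then show ?thesis by (simp add: serve_def)
  next
    case False
    \<comment> \<open>The victim, if any, is an end, so no inner page leaves the cache and the
      potential cannot grow.\<close>
    have sub: "{2..k} - cache ?s = {2..k} - cache s - {p}"
      using False lru_victim_endpoint(2)[OF inv p Cons.prems(2) step False]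
      by (auto simp: serve_def)
    show ?thesis
    proof (cases "p \<in> {1, k+1}")
      case True
      then show ?thesis using False by (simp add: sub card_Diff1_le)
    next
      case mid: False
      have "p \<in> {2..k} - cache s" using mid p False by auto
      then show ?thesis using False mid
        unfolding sub by (subst (2) card.remove[of _ p]) auto
    qed
  qed
  ultimately show ?case using Cons.prems(2) by (auto split: if_splits)
qed simp

lemma respects_path_graph_iff:
  "respects_graph (path_graph N) ps \<longleftrightarrow>
    set ps \<subseteq> {1..N} \<and> successively (\<lambda>p q. p = q \<or> q = Suc p \<or> p = Suc q) ps"
proof -
  have "successively (\<lambda>p q. p = q \<or> (p, q) \<in> parcs (path_graph N)) ps \<longleftrightarrow>
      successively (\<lambda>p q. p = q \<or> q = Suc p \<or> p = Suc q) ps" if "set ps \<subseteq> {1..N}"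
    using that by (intro successively_cong) (auto simp: path_graph_def)
  then show ?thesis by (auto simp: respects_graph_def path_graph_def)
qed

text \<open>The bound depends only on the multiset of requests, so it covers all admissible
  reorderings of a sequence at once. The term \<open>k - 1\<close> is the potential of the empty
  cache.\<close>

lemma LRU_le:
  assumes "k \<ge> 1" "set ps \<subseteq> {1..k+1}" "respects_graph (path_graph N) ps"
  shows "LRU k ps \<le> count (mset ps) 1 + count (mset ps) (k+1) + (k - 1)"
proof (cases ps)
  case (Cons p qs)
  \<comment> \<open>With nothing requested yet the centre is arbitrary; choosing the first page
    makes the first request a step of length 0.\<close>
  have "lru_invar k initial_state {} p"
    by (simp add: lru_invar_def initial_state_def)
  from lru_faults_le[OF this assms(1,2)] show ?thesis
    using assms(3) by (simp add: LRU_def respects_path_graph_iff Cons initial_state_def)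
qed (simp add: LRU_def)


section \<open>Lower bound for the sweeps\<close>

text \<open>The descent omits both ends, so each end occurs exactly once per sweep; the last page,
  2, is adjacent to the first page of the next sweep.\<close>

definition sweep :: "nat \<Rightarrow> nat list" where
  "sweep k = [1..<k+2] @ rev [2..<k+1]"

lemma set_sweep: "set (sweep k) = {1..k+1}"
  by (auto simp: sweep_def)

text \<open>Hits leave the cache unchanged, so every page of a fault-free run was cached from the
  start.\<close>

lemma faults_from_eq_0D:
  assumes "faults_from k v s ps = 0"
  shows "set ps \<subseteq> cache s"
  using assms
proof (induction ps arbitrary: s)
  case (Cons p ps)
  then have "p \<in> cache s" "set ps \<subseteq> cache (serve k v p s)" by (auto split: if_splits)
  then show ?case by (simp add: serve_def)
qed simp

lemma card_cache_serve_lru: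
  assumes "finite (cache s)" "card (cache s) \<le> k" "k \<ge> 1"
  shows "finite (cache (serve k lru_victim p s)) \<and> card (cache (serve k lru_victim p s)) \<le> k"
proof (cases "p \<in> cache s \<or> card (cache s) < k")
  case True
  then show ?thesis using assms by (auto simp: serve_def card_insert_if)
next
  case False
  then have "lru_victim s \<in> cache s"
    using assms by (intro lru_victim_in_cache) auto
  then show ?thesis using assms False by (auto simp: serve_def card_insert_if)
qed

lemma card_cache_fold_lru:
  assumes "finite (cache s)" "card (cache s) \<le> k" "k \<ge> 1"
  shows "finite (cache (fold (serve k lru_victim) ps s)) \<and>
    card (cache (fold (serve k lru_victim) ps s)) \<le> k"
  using assms by (induction ps arbitrary: s) (auto simp: card_cache_serve_lru)

text \<open>A sweep visits \<open>k + 1\<close> distinct pages, which do not fit into the cache, so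
  it causes at least one fault. This crude count suffices for divergence.\<close>

lemma lru_faults_sweeps_ge:
  assumes "finite (cache s)" "card (cache s) \<le> k" "k \<ge> 1"
  shows "n \<le> faults_from k lru_victim s (concat (replicate n (sweep k)))"
  using assms
proof (induction n arbitrary: s)
  case (Suc n)
  have "faults_from k lru_victim s (sweep k) \<noteq> 0"
  proof
    assume "faults_from k lru_victim s (sweep k) = 0"
    from card_mono[OF Suc.prems(1) faults_from_eq_0D[OF this]] show False
      using Suc.prems by (simp add: set_sweep)
  qed
  moreover have "n \<le> faults_from k lru_victim (fold (serve k lru_victim) (sweep k) s)
      (concat (replicate n (sweep k)))"
    using Suc.IH card_cache_fold_lru[OF Suc.prems] Suc.prems(3) by blast
  ultimately show ?case by (simp add: faults_from_append)
qed simp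


section \<open>FIFO on the sweeps\<close>

text \<open>The list is the cache in loading order, so the head is the next victim once the cache is
  full.\<close>

definition fifo_queue :: "'p paging_state \<Rightarrow> 'p list \<Rightarrow> bool" where
  "fifo_queue s q \<longleftrightarrow>
    distinct q \<and> cache s = set q \<and> sorted_wrt (\<lambda>x y. load_time s x < load_time s y) q \<and>
    (\<forall>x\<in>set q. load_time s x < now s)"

lemma fifo_queue_hits:
  assumes "fifo_queue s q" "set ps \<subseteq> set q"
  shows "faults_from k v s ps = 0 \<and> fifo_queue (fold (serve k v) ps s) q"
  using assms
proof (induction ps arbitrary: s)
  case (Cons p ps)
  then have "p \<in> cache s" by (simp add: fifo_queue_def)
  moreover from this have "fifo_queue (serve k v p s) q"
    using Cons.prems(1) by (auto simp: fifo_queue_def serve_def less_Suc_eq)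
  ultimately show ?case using Cons by auto
qed simp

text \<open>The head has the smallest load time, so a full cache drops it. The new page is stamped
  with the clock, which exceeds all stamps in the queue, and so goes to the back.\<close>

lemma fifo_queue_miss:
  assumes q: "fifo_queue s q" and p: "p \<notin> set q" and k: "k \<ge> 1"
  shows "fifo_queue (serve k fifo_victim p s) ((if length q < k then q else tl q) @ [p])"
proof -
  have card: "card (cache s) = length q"
    using q by (simp add: fifo_queue_def distinct_card)
  define r where "r = (if length q < k then q else tl q)"
  have victim: "cache s - {fifo_victim s} = set (tl q)" if full: "\<not> length q < k"
  proof -
    obtain x xs where xs: "q = x # xs" using full k by (cases q) auto
    have "fifo_victim s = x"
      using q by (intro fifo_victim_eqI) (auto simp: fifo_queue_def xs)
    then show ?thesis using q by (auto simp: fifo_queue_def xs)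
  qed
  have cache: "cache (serve k fifo_victim p s) = insert p (set r)"
    using q p victim card by (auto simp: serve_def r_def fifo_queue_def)
  have r: "distinct r" "set r \<subseteq> set q" "sorted_wrt (\<lambda>x y. load_time s x < load_time s y) r"
    using q unfolding r_def fifo_queue_def by (cases q; auto)+
  have load: "load_time (serve k fifo_victim p s) = (load_time s)(p := now s)"
    and now: "now (serve k fifo_victim p s) = Suc (now s)"
    using q p by (auto simp: serve_def fifo_queue_def)
  have "p \<notin> set r" using r p by auto
  have "sorted_wrt (\<lambda>x y. ((load_time s)(p := now s)) x < ((load_time s)(p := now s)) y) r"
    using r(3) by (rule sorted_wrt_mono_rel[rotated]) (use \<open>p \<notin> set r\<close> in auto)
  then show ?thesis
    using q r \<open>p \<notin> set r\<close> unfolding fifo_queue_def cache load now r_def[symmetric]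
    by (auto simp: sorted_wrt_append less_Suc_eq)
qed

text \<open>
  The choice \<open>m = 2\<close> describes the sweep that starts with an empty cache, \<open>m = k + 2\<close> all others.
\<close>

lemma fifo_upward:
  assumes "fifo_queue s [2..<m]" "m = 2 \<or> m = k + 2" "j \<le> k"
  shows "faults_from k fifo_victim s [1..<Suc j] = j \<and>
    fifo_queue (fold (serve k fifo_victim) [1..<Suc j] s) ([j+2..<m] @ [1..<Suc j])"
  using assms(3)
proof (induction j)
  case 0
  then show ?case using assms(1) by (simp add: numeral_2_eq_2)
next
  case (Suc j)
  let ?q = "[j+2..<m] @ [1..<Suc j]"
  let ?s = "fold (serve k fifo_victim) [1..<Suc j] s"
  have q: "fifo_queue ?s ?q" and faults: "faults_from k fifo_victim s [1..<Suc j] = j"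
    using Suc by auto
  have new: "Suc j \<notin> set ?q" by auto
  then have "Suc j \<notin> cache ?s" using q unfolding fifo_queue_def by blast
  \<comment> \<open>For \<open>m = 2\<close> the queue has length \<open>j < k\<close> and nothing
    is evicted. For \<open>m = k + 2\<close> it has length \<open>k\<close>, and its head
    \<open>j + 2\<close> is evicted, exactly the page requested next.\<close>
  moreover have "(if length ?q < k then ?q else tl ?q) @ [Suc j] = [Suc j+2..<m] @ [1..<Suc (Suc j)]"
    using assms(2) Suc.prems by (auto simp: upt_conv_Cons)
  ultimately show ?case
    using fifo_queue_miss[OF q new, of k] Suc.prems faults
    by (simp add: faults_from_append)
qed

text \<open>After \<open>k\<close> upward faults the queue is \<open>1, ..., k\<close>; the fault on
  \<open>k + 1\<close> evicts 1, and the descent then only hits. The final queue is again of the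
  assumed form, with \<open>m = k + 2\<close>, so sweeps can be iterated.\<close>

lemma fifo_sweep:
  assumes "fifo_queue s [2..<m]" "m = 2 \<or> m = k + 2" "k \<ge> 1"
  shows "faults_from k fifo_victim s (sweep k) = k + 1 \<and>
    fifo_queue (fold (serve k fifo_victim) (sweep k) s) [2..<k+2]"
proof -
  let ?s = "fold (serve k fifo_victim) [1..<k+1] s"
  let ?t = "serve k fifo_victim (k+1) ?s"
  have q: "fifo_queue ?s [1..<k+1]" and faults: "faults_from k fifo_victim s [1..<k+1] = k"
    using fifo_upward[OF assms(1,2), of k] assms(2) by auto
  have miss: "k + 1 \<notin> cache ?s" using q by (auto simp: fifo_queue_def)
  have "tl [1..<k+1] @ [k+1] = [2..<k+2]"
    using assms(3) by (auto simp: upt_conv_Cons numeral_2_eq_2)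
  then have t: "fifo_queue ?t [2..<k+2]"
    using fifo_queue_miss[OF q, of "k+1" k] assms(3) by auto
  have "sweep k = [1..<k+1] @ [k+1] @ rev [2..<k+1]" using assms(3) by (simp add: sweep_def)
  then show ?thesis
    using fifo_queue_hits[OF t, of "rev [2..<k+1]" k fifo_victim] faults miss
    by (auto simp: faults_from_append simp del: upt_Suc)
qed

lemma fifo_faults_sweeps:
  assumes "fifo_queue s [2..<m]" "m = 2 \<or> m = k + 2" "k \<ge> 1"
  shows "faults_from k fifo_victim s (concat (replicate n (sweep k))) = n * (k + 1)"
  using assms
proof (induction n arbitrary: s m)
  case (Suc n)
  from fifo_sweep[OF Suc.prems] Suc.IH[of _ "k+2"] Suc.prems(3)
  show ?case by (simp add: faults_from_append)
qed simp

lemma FIFO_sweeps: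
  assumes "k \<ge> 1"
  shows "FIFO k (concat (replicate n (sweep k))) = n * (k + 1)"
  unfolding FIFO_def
  by (rule fifo_faults_sweeps[of _ 2]) (use assms in \<open>auto simp: fifo_queue_def initial_state_def\<close>)


section \<open>Worst orders\<close>

lemma finite_orders:
  "finite {A (permute_list \<sigma> I) | \<sigma>.
    \<sigma> permutes {..<length I} \<and> respects_graph G (permute_list \<sigma> I)}"
  by (rule finite_subset[OF _ finite_imageI[OF finite_permutations[OF finite_lessThan],
        of "\<lambda>\<sigma>. A (permute_list \<sigma> I)"]]) auto

lemma worst_order_ge:
  assumes "respects_graph G I"
  shows "A I \<le> worst_order A G I"
  unfolding worst_order_def
proof (rule Max_ge[OF finite_orders])
  show "A I \<in> {A (permute_list \<sigma> I) | \<sigma>.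
      \<sigma> permutes {..<length I} \<and> respects_graph G (permute_list \<sigma> I)}"
    using assms permutes_id[of "{..<length I}"]
    by (intro CollectI exI[of _ id]) simp
qed

text \<open>Permuted lists have the same multiset as \<open>I\<close>, so the permutations
  themselves can be forgotten. That \<open>I\<close> respects \<open>G\<close> makes the set under
  \<open>Max\<close> nonempty, by the identity permutation.\<close>

lemma worst_order_le:
  assumes "respects_graph G I"
    and "\<And>J. mset J = mset I \<Longrightarrow> respects_graph G J \<Longrightarrow> A J \<le> B"
  shows "worst_order A G I \<le> B"
  unfolding worst_order_def
proof (rule Max.boundedI[OF finite_orders])
  show "{A (permute_list \<sigma> I) | \<sigma>.
      \<sigma> permutes {..<length I} \<and> respects_graph G (permute_list \<sigma> I)} \<noteq> {}"
    using assms(1) permutes_id[of "{..<length I}"]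
    by (simp, intro exI[of _ id]) simp
qed (use assms(2) in auto)

lemma count_sweeps:
  "count (mset (concat (replicate n (sweep k)))) 1 = n"
  "k \<ge> 1 \<Longrightarrow> count (mset (concat (replicate n (sweep k)))) (k+1) = n"
  by (induction n) (auto simp: sweep_def)

lemma successively_sweep:
  assumes "k \<ge> 1"
  shows "successively (\<lambda>p q. p = q \<or> q = Suc p \<or> p = Suc q) (sweep k)"
proof -
  have up: "successively (\<lambda>p q. p = q \<or> q = Suc p \<or> p = Suc q) [i..<j]" for i j
    by (induction j) (auto simp: successively_append_iff)
  have "successively (\<lambda>p q. p = q \<or> q = Suc p \<or> p = Suc q) (rev [i..<j])" for i j
    using up[of i j] by (auto elim: successively_mono)
  with up show ?thesis
    unfolding sweep_def by (auto simp: successively_append_iff hd_rev simp del: upt_Suc)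
qed

lemma respects_sweeps:
  assumes "k \<ge> 1" "N \<ge> k + 1"
  shows "respects_graph (path_graph N) (concat (replicate n (sweep k)))"
proof -
  have ends: "sweep k \<noteq> []" "hd (sweep k) = 1" "last (sweep k) = 2"
    using assms(1) by (auto simp: sweep_def last_rev upt_conv_Cons simp del: upt_Suc)
  have "successively (\<lambda>p q. p = q \<or> q = Suc p \<or> p = Suc q) (concat (replicate n (sweep k)))"
  proof (induction n)
    case (Suc n)
    then show ?case
      using successively_sweep[OF assms(1)] ends
      by (cases n) (auto simp: successively_append_iff)
  qed simp
  moreover have "set (concat (replicate n (sweep k))) \<subseteq> {1..N}"
    using assms(2) by (auto simp: set_sweep)
  ultimately show ?thesis by (simp add: respects_path_graph_iff)
qed

theorem theorem4:
  fixes k N :: nat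
  assumes "k \<ge> 1" and "N \<ge> k + 1"
  shows "\<exists>(I :: nat \<Rightarrow> nat list) (b :: real).
    (\<forall>n\<ge>1. respects_graph (path_graph N) (I n)) \<and>
    filterlim (\<lambda>n. LRU k (I n)) at_top sequentially \<and>
    (\<forall>n\<ge>1. real (worst_order (FIFO k) (path_graph N) (I n))
            \<ge> (real k + 1) / 2 * real (worst_order (LRU k) (path_graph N) (I n)) + b)"
proof -
  define I where "I n = concat (replicate n (sweep k))" for n
  \<comment> \<open>Cancels \<open>(k + 1) / 2\<close> times the additive term \<open>k - 1\<close>
    of the LRU bound, so that both sides meet at \<open>n * (k + 1)\<close>.\<close>
  define b where "b = - ((real k + 1) / 2 * (real k - 1))"
  have resp: "respects_graph (path_graph N) (I n)" for n
    unfolding I_def using assms by (rule respects_sweeps)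
  have "n \<le> LRU k (I n)" for n
    unfolding LRU_def I_def
    by (rule lru_faults_sweeps_ge) (use assms in \<open>auto simp: initial_state_def\<close>)
  then have lim: "filterlim (\<lambda>n. LRU k (I n)) at_top sequentially"
    by (intro filterlim_at_top_mono[OF filterlim_ident]) auto
  have "(real k + 1) / 2 * real (worst_order (LRU k) (path_graph N) (I n)) + b
      \<le> real (worst_order (FIFO k) (path_graph N) (I n))" for n
  proof -
    \<comment> \<open>Every reordering still contains each of the two ends \<open>n\<close>
      times.\<close>
    have "worst_order (LRU k) (path_graph N) (I n) \<le> 2 * n + (k - 1)"
    proof (rule worst_order_le[OF resp])
      fix J assume J: "mset J = mset (I n)" "respects_graph (path_graph N) J"
      have "set J = set (I n)" using J(1) by (rule mset_eq_setD)
      then have "set J \<subseteq> {1..k+1}" by (auto simp: I_def set_sweep)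
      from LRU_le[OF assms(1) this J(2)] show "LRU k J \<le> 2 * n + (k - 1)"
        unfolding J(1) I_def count_sweeps(1) count_sweeps(2)[OF assms(1)] by simp
    qed
    then have "real (worst_order (LRU k) (path_graph N) (I n)) \<le> 2 * real n + (real k - 1)"
      using assms(1) by linarith
    then have "(real k + 1) / 2 * real (worst_order (LRU k) (path_graph N) (I n))
        \<le> (real k + 1) / 2 * (2 * real n + (real k - 1))"
      by (rule mult_left_mono) simp
    also have "\<dots> = real (n * (k + 1)) - b"
      by (simp add: b_def field_simps)
    \<comment> \<open>For FIFO the sweeps in their given order already witness the bound.\<close>
    also have "n * (k + 1) \<le> worst_order (FIFO k) (path_graph N) (I n)"
      using worst_order_ge[OF resp, of "FIFO k" n] FIFO_sweeps[OF assms(1), of n]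
      by (simp add: I_def)
    finally show ?thesis by simp
  qed
  with resp lim show ?thesis by blast
qed

end
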